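(* Let $f\in K[x_1,\ldots,x_n]$ be a homogeneous polynomial of degree at least $2$ with zero Hessian. Then a variable can be eliminated from $f$ and all its partial derivatives simultaneously by a birational transformation of the variables; that is, there exist $u_1,\ldots,u_n\in K(x_1,\ldots,x_n)$ with $K(u_1,\ldots,u_n)=K(x_1,\ldots,x_n)$ such that $f\in K(u_1,\ldots,u_{n-1})$ and $\frac{\partial f}{\partial x_j}\in K(u_1,\ldots,u_{n-1})$ for every $j=1,\ldots,n$.
   Context: $K$ is an algebraically closed field of characteristic zero. A homogeneous polynomial $f\in K[x_1,\ldots,x_n]$ has zero Hessian if $\det\left(\frac{\partial^2 f}{\partial x_i\partial x_j}\right)_{1\le i,j\le n}=0$ as a polynomial. *)

theory Defs
  imports
    "HOL-Library.Poly_Mapping"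
    "HOL-Computational_Algebra.Normalized_Fraction"
    "Jordan_Normal_Form.Determinant"
begin

text \<open>
  The variables are indexed from 0: \<open>x\<^sub>1, \<dots>, x\<^sub>n\<close> are represented by the
  indices \<open>0, \<dots>, n - 1\<close>. The type \<open>'a mpoly\<close> has a variable for every natural number;
  \<open>K[x\<^sub>1, \<dots>, x\<^sub>n]\<close> and \<open>K(x\<^sub>1, \<dots>, x\<^sub>n)\<close> are the subsets
  \<open>polys n\<close> and \<open>ratfuns n\<close> below.
\<close>

type_synonym 'a mpoly = "(nat \<Rightarrow>\<^sub>0 nat) \<Rightarrow>\<^sub>0 'a"

type_synonym 'a ratfun = "'a mpoly fract"

definition polys :: "nat \<Rightarrow> 'a::zero mpoly set" where
  "polys n = {p. \<forall>m \<in> Poly_Mapping.keys p. Poly_Mapping.keys m \<subseteq> {..<n}}"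

definition Const :: "'a::zero \<Rightarrow> 'a mpoly" where
  "Const c = Poly_Mapping.single 0 c"

definition Var :: "nat \<Rightarrow> 'a::zero_neq_one mpoly" where
  "Var i = Poly_Mapping.single (Poly_Mapping.single i 1) 1"

definition mdeg :: "(nat \<Rightarrow>\<^sub>0 nat) \<Rightarrow> nat" where
  "mdeg m = (\<Sum>i \<in> Poly_Mapping.keys m. Poly_Mapping.lookup m i)"

text \<open>As usual, the zero polynomial is homogeneous of every degree.\<close>

definition homogeneous :: "nat \<Rightarrow> 'a::zero mpoly \<Rightarrow> bool" where
  "homogeneous d p \<longleftrightarrow> (\<forall>m \<in> Poly_Mapping.keys p. mdeg m = d)"

text \<open>
  The subtraction of exponents is truncated, but where it truncates the coefficient vanishes.
\<close>

definition pd :: "nat \<Rightarrow> 'a::comm_semiring_1 mpoly \<Rightarrow> 'a mpoly" where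
  "pd i p = (\<Sum>m \<in> Poly_Mapping.keys p.
     Poly_Mapping.single (m - Poly_Mapping.single i 1)
       (of_nat (Poly_Mapping.lookup m i) * Poly_Mapping.lookup p m))"

definition hessian :: "nat \<Rightarrow> 'a::comm_ring_1 mpoly \<Rightarrow> 'a mpoly mat" where
  "hessian n p = mat n n (\<lambda>(i, j). pd i (pd j p))"

definition zero_hessian :: "nat \<Rightarrow> 'a::comm_ring_1 mpoly \<Rightarrow> bool" where
  "zero_hessian n p \<longleftrightarrow> det (hessian n p) = 0"

definition ratfuns :: "nat \<Rightarrow> 'a::field ratfun set" where
  "ratfuns n = {Fract p q | p q. p \<in> polys n \<and> q \<in> polys n \<and> q \<noteq> 0}"

text \<open>
  \<open>adjoin S\<close> is \<open>K(S)\<close>, the smallest subfield containing the constants and \<open>S\<close>.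
  Negatives are products with the constant \<open>-1\<close>; the rule for inverses is harmless
  at \<open>0\<close> because \<open>inverse 0 = 0\<close>.
\<close>

inductive_set adjoin :: "'a::field ratfun set \<Rightarrow> 'a ratfun set" for S where
  const: "to_fract (Const c) \<in> adjoin S"
| incl: "a \<in> S \<Longrightarrow> a \<in> adjoin S"
| add: "a \<in> adjoin S \<Longrightarrow> b \<in> adjoin S \<Longrightarrow> a + b \<in> adjoin S"
| mult: "a \<in> adjoin S \<Longrightarrow> b \<in> adjoin S \<Longrightarrow> a * b \<in> adjoin S"
| inv: "a \<in> adjoin S \<Longrightarrow> inverse a \<in> adjoin S"

lemma lookup_pd:
  "Poly_Mapping.lookup (pd i p) m =
     of_nat (Poly_Mapping.lookup m i + 1) * Poly_Mapping.lookup p (m + Poly_Mapping.single i 1)"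
proof -
  let ?s = "Poly_Mapping.single i (1::nat)"
  have key: "k = m + ?s" if "k - ?s = m" "Poly_Mapping.lookup k i \<noteq> 0" for k
    using that by (auto intro!: poly_mapping_eqI simp: lookup_add lookup_minus lookup_single when_def)
  have "Poly_Mapping.lookup (pd i p) m =
      (\<Sum>k\<in>Poly_Mapping.keys p. (of_nat (Poly_Mapping.lookup k i) * Poly_Mapping.lookup p k when k - ?s = m))"
    by (simp add: pd_def lookup_sum lookup_single)
  also have "\<dots> = (\<Sum>k\<in>Poly_Mapping.keys p.
      if k = m + ?s then of_nat (Poly_Mapping.lookup k i) * Poly_Mapping.lookup p k else 0)"
    by (rule sum.cong[OF refl]) (use key in \<open>fastforce simp: when_def\<close>)
  also have "\<dots> = of_nat (Poly_Mapping.lookup m i + 1) * Poly_Mapping.lookup p (m + ?s)"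
    by (auto simp: lookup_add lookup_single in_keys_iff)
  finally show ?thesis .
qed

lemma polys_add: "p \<in> polys n \<Longrightarrow> q \<in> polys n \<Longrightarrow> p + q \<in> polys n"
  using Poly_Mapping.keys_add[of p q] by (auto simp: polys_def)

lemma polys_mult: "p \<in> polys n \<Longrightarrow> q \<in> polys n \<Longrightarrow> p * q \<in> polys n"
  for p q :: "'a::semiring_0 mpoly"
proof -
  assume *: "p \<in> polys n" "q \<in> polys n"
  have "Poly_Mapping.keys m \<subseteq> {..<n}" if m: "m \<in> Poly_Mapping.keys (p * q)" for m
  proof -
    from m obtain a b where "m = a + b" "a \<in> Poly_Mapping.keys p" "b \<in> Poly_Mapping.keys q"
      using keys_mult[of p q] by blast
    then show ?thesis
      using * Poly_Mapping.keys_add[of a b] unfolding polys_def by blast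
  qed
  then show ?thesis by (auto simp: polys_def)
qed

lemma polys_Const: "Const c \<in> polys n"
  by (auto simp: polys_def Const_def split: if_splits)

lemma polys_Var: "i < n \<Longrightarrow> Var i \<in> polys n"
  by (auto simp: polys_def Var_def split: if_splits)

lemma to_fract_in_ratfuns: "p \<in> polys n \<Longrightarrow> to_fract p \<in> ratfuns n"
proof -
  assume "p \<in> polys n"
  moreover have "1 \<in> polys n" by (simp add: polys_def)
  ultimately show ?thesis
    unfolding ratfuns_def to_fract_def using zero_neq_one by fastforce
qed

lemma poly_mapping_sum_monomials:
  "(\<Sum>k\<in>Poly_Mapping.keys p. Poly_Mapping.single k (Poly_Mapping.lookup p k)) = p"
  by (rule poly_mapping_eqI) (simp add: lookup_sum lookup_single when_def in_keys_iff)

lemma ratfuns_eq_adjoin: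
  "ratfuns n = adjoin ((\<lambda>i. to_fract (Var i)) ` {..<n} :: 'a::field ratfun set)" (is "_ = ?A")
proof (intro Set.equalityI Set.subsetI)
  fix r :: "'a ratfun"
  assume "r \<in> ?A"
  then show "r \<in> ratfuns n"
  proof induction
    case (const c)
    show ?case by (rule to_fract_in_ratfuns[OF polys_Const])
  next
    case (incl a)
    then show ?case by (auto intro: to_fract_in_ratfuns polys_Var)
  next
    case (add a b)
    then obtain p q p' q' where
      "a = Fract p q" "p \<in> polys n" "q \<in> polys n" "q \<noteq> 0"
      "b = Fract p' q'" "p' \<in> polys n" "q' \<in> polys n" "q' \<noteq> 0"
      unfolding ratfuns_def by blast
    then show ?case
      unfolding ratfuns_def
      by (intro CollectI exI[of _ "p * q' + p' * q"] exI[of _ "q * q'"])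
         (auto intro: polys_add polys_mult)
  next
    case (mult a b)
    then obtain p q p' q' where
      "a = Fract p q" "p \<in> polys n" "q \<in> polys n" "q \<noteq> 0"
      "b = Fract p' q'" "p' \<in> polys n" "q' \<in> polys n" "q' \<noteq> 0"
      unfolding ratfuns_def by blast
    then show ?case
      unfolding ratfuns_def
      by (intro CollectI exI[of _ "p * p'"] exI[of _ "q * q'"]) (auto intro: polys_mult)
  next
    case (inv a)
    then obtain p q where
      *: "a = Fract p q" "p \<in> polys n" "q \<in> polys n" "q \<noteq> 0"
      unfolding ratfuns_def by blast
    show ?case
    proof (cases "p = 0")
      case True
      then have "inverse a = a" using * by (simp add: fract_collapse)
      with inv show ?thesis by simp
    next
      case False
      then show ?thesis using * unfolding ratfuns_def by auto
    qed
  qed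
next
  fix r :: "'a ratfun"
  assume "r \<in> ratfuns n"
  then obtain p q where r: "r = Fract p q" "p \<in> polys n" "q \<in> polys n"
    unfolding ratfuns_def by blast
  have pow: "to_fract (Poly_Mapping.single (Poly_Mapping.single i k) (1::'a)) \<in> ?A"
    if "i < n" for i k
  proof (induction k)
    case 0
    show ?case using adjoin.const[of 1] by (simp add: Const_def)
  next
    case (Suc k)
    have "Poly_Mapping.single (Poly_Mapping.single i (Suc k)) (1::'a) =
        Var i * Poly_Mapping.single (Poly_Mapping.single i k) 1"
      by (simp add: Var_def mult_single flip: single_add)
    then show ?case
      using Suc that by (auto intro: adjoin.mult adjoin.incl)
  qed
  have mon: "to_fract (Poly_Mapping.single m (c::'a)) \<in> ?A"
    if m: "Poly_Mapping.keys m \<subseteq> {..<n}" for m c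
  proof -
    have "to_fract (Poly_Mapping.single (\<Sum>i\<in>B. Poly_Mapping.single i (g i)) c) \<in> ?A"
      if "finite B" "B \<subseteq> {..<n}" for B g
      using that
    proof (induction B rule: finite_induct)
      case empty
      show ?case using adjoin.const[of c] by (simp add: Const_def)
    next
      case (insert i B)
      have "Poly_Mapping.single (\<Sum>i\<in>insert i B. Poly_Mapping.single i (g i)) c =
          Poly_Mapping.single (Poly_Mapping.single i (g i)) 1 *
          Poly_Mapping.single (\<Sum>i\<in>B. Poly_Mapping.single i (g i)) c"
        using insert by (simp add: mult_single)
      then show ?case
        using insert pow[of i "g i"] by (auto intro: adjoin.mult)
    qed
    from this[of "Poly_Mapping.keys m" "Poly_Mapping.lookup m"] m show ?thesis
      by (simp add: poly_mapping_sum_monomials)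
  qed
  have poly: "to_fract p \<in> ?A" if p: "p \<in> polys n" for p :: "'a mpoly"
  proof -
    have "to_fract (\<Sum>m\<in>B. Poly_Mapping.single m (g m)) \<in> ?A"
      if "finite B" "\<forall>m\<in>B. Poly_Mapping.keys m \<subseteq> {..<n}" for B and g :: "_ \<Rightarrow> 'a"
      using that
    proof (induction B rule: finite_induct)
      case empty
      show ?case using adjoin.const[of 0] by (simp add: Const_def)
    next
      case (insert m B)
      then show ?case by (auto intro: adjoin.add mon)
    qed
    from this[of "Poly_Mapping.keys p" "Poly_Mapping.lookup p"] p show ?thesis
      by (simp add: poly_mapping_sum_monomials polys_def)
  qed
  have eq: "r = to_fract p * inverse (to_fract q)"
    using r by (simp add: to_fract_def)
  show "r \<in> ?A"
    unfolding eq by (intro adjoin.mult adjoin.inv poly r)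
qed

end

theory Submission
  imports Defs
begin

text \<open>
  Let \<open>H \<noteq> 0\<close> be a polynomial vector of minimal support in the kernel of the Hessian of \<open>f\<close>, say with
  \<open>H\<^sub>k \<noteq> 0\<close>, and let \<open>D = \<Sum> H\<^sub>i \<partial>\<^sub>i\<close>. The vector \<open>D H\<close> lies in the kernel as well, hence so does
  \<open>H\<^sub>k D H - (D H\<^sub>k) H\<close>, which vanishes because its support is smaller. So \<open>h = H / H\<^sub>k\<close> consists of
  constants of \<open>D\<close>. The partial derivatives of \<open>f\<close> are constants of \<open>D\<close> by the choice of \<open>H\<close>, and by Euler's
  formula so is \<open>f\<close>. Constants of \<open>D\<close> are invariant under \<open>x \<mapsto> x + t h\<close>, and \<open>t = c - x\<^sub>k\<close>, with a scalar \<open>c\<close>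
  for which no denominator vanishes, turns them into rational functions of the
  \<open>u\<^sub>i = x\<^sub>i + (c - x\<^sub>k) h\<^sub>i\<close> with \<open>i \<noteq> k\<close>, because the \<open>k\<close>-th coordinate becomes \<open>c\<close>. In particular the \<open>h\<^sub>i\<close>
  are rational functions of these \<open>u\<^sub>i\<close>, so adjoining \<open>x\<^sub>k\<close> recovers every \<open>x\<^sub>i\<close>.
\<close>

section \<open>Partial derivatives of polynomials\<close>

lemma mpoly_additive_induct [case_names single add]:
  fixes p :: "'a::comm_monoid_add mpoly"
  assumes "\<And>m c. P (Poly_Mapping.single m c)"
    and "\<And>p q. P p \<Longrightarrow> P q \<Longrightarrow> P (p + q)"
  shows "P p"
proof -
  have "P (\<Sum>k\<in>A. Poly_Mapping.single k (Poly_Mapping.lookup p k))" if "finite A" for A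
    using that
  proof (induction A rule: finite_induct)
    case empty
    show ?case using assms(1)[of 0 0] by simp
  qed (simp add: assms)
  from this[of "Poly_Mapping.keys p"] show ?thesis
    by (simp add: poly_mapping_sum_monomials)
qed

lemma pd_add: "pd i (p + q) = pd i p + pd i q"
  by (rule poly_mapping_eqI) (simp add: lookup_pd lookup_add algebra_simps)

lemma pd_0 [simp]: "pd i 0 = 0"
  by (simp add: pd_def)

lemma pd_sum: "pd i (\<Sum>x\<in>A. g x) = (\<Sum>x\<in>A. pd i (g x))"
  by (induction A rule: infinite_finite_induct) (simp_all add: pd_add)

lemma pd_commute: "pd i (pd j p) = pd j (pd i p)"
  by (rule poly_mapping_eqI)
    (cases "i = j"; simp add: lookup_pd lookup_add lookup_single mult.left_commute add.assoc
      add.commute[of "Poly_Mapping.single i (Suc 0)"])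

lemma pd_single:
  "pd i (Poly_Mapping.single m c) =
    Poly_Mapping.single (m - Poly_Mapping.single i 1) (of_nat (Poly_Mapping.lookup m i) * c)"
  by (cases "c = 0") (simp_all add: pd_def)

lemma pd_Const [simp]: "pd i (Const c) = 0"
  by (simp add: Const_def pd_single)

lemma pd_Var: "pd i (Var j) = (if i = j then 1 else 0)"
  by (auto simp: Var_def pd_single lookup_single when_def)

lemma pd_mult: "pd i (p * q) = pd i p * q + p * pd i q"
  for p q :: "'a::comm_semiring_1 mpoly"
proof (induction p rule: mpoly_additive_induct)
  case (single a c)
  show ?case
  proof (induction q rule: mpoly_additive_induct)
    case (single b d)
    let ?s = "Poly_Mapping.single i (1::nat)"
    \<comment> \<open>Where the truncated subtraction breaks associativity, the exponent of the
      variable in \<open>a\<close> is zero; the coefficient is then zero and both monomials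
      vanish.\<close>
    have l: "Poly_Mapping.single (a - ?s + b) (of_nat (Poly_Mapping.lookup a i) * c * d) =
        Poly_Mapping.single (a + b - ?s) (of_nat (Poly_Mapping.lookup a i) * c * d)"
    proof (cases "Poly_Mapping.lookup a i = 0")
      case False
      then have "a - ?s + b = a + b - ?s"
        by (intro poly_mapping_eqI) (auto simp: lookup_add lookup_minus lookup_single when_def)
      then show ?thesis by simp
    qed simp
    have r: "Poly_Mapping.single (a + (b - ?s)) (of_nat (Poly_Mapping.lookup b i) * c * d) =
        Poly_Mapping.single (a + b - ?s) (of_nat (Poly_Mapping.lookup b i) * c * d)"
    proof (cases "Poly_Mapping.lookup b i = 0")
      case False
      then have "a + (b - ?s) = a + b - ?s"
        by (intro poly_mapping_eqI) (auto simp: lookup_add lookup_minus lookup_single when_def)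
      then show ?thesis by simp
    qed simp
    show ?case
      using l r by (simp add: pd_single mult_single lookup_add algebra_simps flip: single_add)
  qed (simp add: pd_add algebra_simps)
qed (simp add: pd_add algebra_simps)

lemma pd_eq_0: "p \<in> polys n \<Longrightarrow> n \<le> i \<Longrightarrow> pd i p = 0"
proof (rule poly_mapping_eqI)
  fix m
  assume "p \<in> polys n" "n \<le> i"
  moreover have "i \<in> Poly_Mapping.keys (m + Poly_Mapping.single i (1::nat))"
    by (simp add: in_keys_iff lookup_add)
  ultimately have "m + Poly_Mapping.single i (1::nat) \<notin> Poly_Mapping.keys p"
    unfolding polys_def by fastforce
  then show "Poly_Mapping.lookup (pd i p) m = Poly_Mapping.lookup 0 m"
    by (simp add: lookup_pd in_keys_iff)
qed

text \<open>In characteristic zero a monomial containing the variable \<open>i\<close> survives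
  \<open>pd i\<close>, since its exponent is a nonzero scalar. This makes membership in
  \<open>polys n\<close> testable by differentiation.\<close>

lemma polys_if_pd_eq_0:
  fixes p :: "'a::{idom, ring_char_0} mpoly"
  assumes "\<And>i. i \<ge> n \<Longrightarrow> pd i p = 0"
  shows "p \<in> polys n"
  unfolding polys_def
proof (intro CollectI ballI subsetI)
  fix m i
  assume m: "m \<in> Poly_Mapping.keys p" and i: "i \<in> Poly_Mapping.keys m"
  have "m - Poly_Mapping.single i 1 + Poly_Mapping.single i 1 = m"
    using i by (intro poly_mapping_eqI)
      (auto simp: lookup_add lookup_minus lookup_single when_def in_keys_iff)
  then have "Poly_Mapping.lookup (pd i p) (m - Poly_Mapping.single i 1) \<noteq> 0"
    using m by (simp add: lookup_pd in_keys_iff del: of_nat_add of_nat_Suc)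
  then have "pd i p \<noteq> 0" by auto
  with assms show "i \<in> {..<n}" by (metis lessThan_iff not_le)
qed

section \<open>Degrees and Euler's formula\<close>

lemma mdeg_add: "mdeg (a + b) = mdeg a + mdeg b"
proof -
  have *: "mdeg m = (\<Sum>i\<in>Poly_Mapping.keys a \<union> Poly_Mapping.keys b. Poly_Mapping.lookup m i)"
    if "Poly_Mapping.keys m \<subseteq> Poly_Mapping.keys a \<union> Poly_Mapping.keys b" for m
    unfolding mdeg_def using that by (intro sum.mono_neutral_left) (auto simp: in_keys_iff)
  show ?thesis
    by (simp add: * Poly_Mapping.keys_add lookup_add sum.distrib)
qed

lemma mdeg_single [simp]: "mdeg (Poly_Mapping.single i k) = k"
  by (simp add: mdeg_def)

lemma keys_pd: "m \<in> Poly_Mapping.keys (pd i p) \<Longrightarrow> m + Poly_Mapping.single i 1 \<in> Poly_Mapping.keys p"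
  by (auto simp: in_keys_iff lookup_pd)

lemma polys_pd: "p \<in> polys n \<Longrightarrow> pd i p \<in> polys n"
  unfolding polys_def
proof (intro CollectI ballI)
  fix m
  assume "p \<in> {p. \<forall>m\<in>Poly_Mapping.keys p. Poly_Mapping.keys m \<subseteq> {..<n}}"
    and "m \<in> Poly_Mapping.keys (pd i p)"
  then have "Poly_Mapping.keys (m + Poly_Mapping.single i 1) \<subseteq> {..<n}"
    using keys_pd by blast
  moreover have "Poly_Mapping.keys m \<subseteq> Poly_Mapping.keys (m + Poly_Mapping.single i 1)"
    by (auto simp: in_keys_iff lookup_add)
  ultimately show "Poly_Mapping.keys m \<subseteq> {..<n}" by blast
qed

lemma homogeneous_pd: "homogeneous (Suc d) p \<Longrightarrow> homogeneous d (pd i p)"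
  unfolding homogeneous_def using keys_pd by (fastforce simp: mdeg_add)

text \<open>On a monomial, x_i times the i-th derivative multiplies by the exponent of x_i, and the
  exponents sum to the degree.\<close>

lemma euler_homogeneous:
  fixes p :: "'a::comm_semiring_1 mpoly"
  assumes "p \<in> polys n" "homogeneous d p"
  shows "(\<Sum>i<n. Var i * pd i p) = of_nat d * p"
proof -
  let ?m = "\<lambda>m. Poly_Mapping.single m (Poly_Mapping.lookup p m)"
  have monom: "(\<Sum>i<n. Var i * pd i (?m m)) = of_nat d * ?m m" if m: "m \<in> Poly_Mapping.keys p" for m
  proof -
    have "Var i * pd i (?m m) = of_nat (Poly_Mapping.lookup m i) * ?m m" for i
    proof (cases "Poly_Mapping.lookup m i = 0")
      case False
      then have "Poly_Mapping.single i 1 + (m - Poly_Mapping.single i 1) = m"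
        by (intro poly_mapping_eqI) (auto simp: lookup_add lookup_minus lookup_single when_def)
      then show ?thesis
        by (simp add: Var_def pd_single mult_single flip: single_of_nat)
    qed (simp add: pd_single)
    then have "(\<Sum>i<n. Var i * pd i (?m m)) = of_nat (\<Sum>i<n. Poly_Mapping.lookup m i) * ?m m"
      by (simp add: sum_distrib_right)
    also have "(\<Sum>i<n. Poly_Mapping.lookup m i) = mdeg m"
      unfolding mdeg_def using assms(1) m
      by (intro sum.mono_neutral_right) (auto simp: polys_def in_keys_iff)
    also have "\<dots> = d" using assms(2) m by (simp add: homogeneous_def)
    finally show ?thesis .
  qed
  have "(\<Sum>i<n. Var i * pd i (\<Sum>m\<in>Poly_Mapping.keys p. ?m m)) =
      (\<Sum>m\<in>Poly_Mapping.keys p. \<Sum>i<n. Var i * pd i (?m m))"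
    unfolding pd_sum sum_distrib_left by (rule sum.swap)
  also have "\<dots> = of_nat d * (\<Sum>m\<in>Poly_Mapping.keys p. ?m m)"
    by (simp add: monom sum_distrib_left)
  finally show ?thesis by (simp add: poly_mapping_sum_monomials)
qed

lemma of_nat_mpoly_eq_0_iff [simp]: "(of_nat k :: 'a::semiring_char_0 mpoly) = 0 \<longleftrightarrow> k = 0"
proof -
  have "(of_nat k :: 'a mpoly) = Poly_Mapping.single 0 (of_nat k)" by simp
  then show ?thesis by (metis of_nat_eq_0_iff lookup_single_eq lookup_zero single_zero)
qed

lemma of_nat_ratfun_eq_0_iff [simp]: "(of_nat k :: 'a::field_char_0 ratfun) = 0 \<longleftrightarrow> k = 0"
  by (simp add: of_nat_fract Zero_fract_def eq_fract)

section \<open>Derivations\<close>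

locale derivation =
  fixes \<delta> :: "'a::idom \<Rightarrow> 'a"
  assumes add: "\<delta> (x + y) = \<delta> x + \<delta> y"
    and mult: "\<delta> (x * y) = \<delta> x * y + x * \<delta> y"
begin

lemma zero [simp]: "\<delta> 0 = 0"
  using add[of 0 0] by (simp only: add_0_left add_cancel_right_left)

lemma one [simp]: "\<delta> 1 = 0"
  using mult[of 1 1] by (simp only: mult_1_left mult_1_right add_cancel_right_left)

lemma sum: "\<delta> (\<Sum>i\<in>A. g i) = (\<Sum>i\<in>A. \<delta> (g i))"
  by (induction A rule: infinite_finite_induct) (simp_all add: add)

lemma scale: "derivation (\<lambda>x. c * \<delta> x)"
  by unfold_locales (simp_all add: add mult algebra_simps)

lemma map_poly: "derivation (map_poly \<delta>)"
proof
  fix p q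
  show "map_poly \<delta> (p + q) = map_poly \<delta> p + map_poly \<delta> q"
    by (rule poly_eqI) (simp add: coeff_map_poly add)
  show "map_poly \<delta> (p * q) = map_poly \<delta> p * q + p * map_poly \<delta> q"
    by (rule poly_eqI) (simp add: coeff_map_poly coeff_mult sum mult sum.distrib)
qed

end

text \<open>The quotient rule on an arbitrarily chosen representative;
  \<open>fract_der_Fract\<close> shows that for a derivation the choice is immaterial.\<close>

definition fract_der :: "('a::idom \<Rightarrow> 'a) \<Rightarrow> 'a fract \<Rightarrow> 'a fract" where
  "fract_der \<delta> x =
    (let (p, q) = SOME (p, q). q \<noteq> 0 \<and> x = Fract p q in Fract (\<delta> p * q - p * \<delta> q) (q * q))"

context derivation
begin

text \<open>Differentiating the cross relation \<open>p * b = a * q\<close> of two representatives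
  links their derivatives, which makes the two quotient rules agree.\<close>

lemma fract_der_Fract:
  assumes "q \<noteq> 0"
  shows "fract_der \<delta> (Fract p q) = Fract (\<delta> p * q - p * \<delta> q) (q * q)"
proof -
  define s where "s = (SOME (p', q'). q' \<noteq> 0 \<and> Fract p q = Fract p' q')"
  obtain a b where ab: "s = (a, b)" by fastforce
  have "case s of (p', q') \<Rightarrow> q' \<noteq> 0 \<and> Fract p q = Fract p' q'"
    unfolding s_def by (rule someI[of _ "(p, q)"]) (simp add: assms)
  then have b: "b \<noteq> 0" and "Fract p q = Fract a b" by (simp_all add: ab)
  with assms have eq: "p * b = a * q" by (metis eq_fract(1))
  have d: "\<delta> p * b + p * \<delta> b = \<delta> a * q + a * \<delta> q"
    using arg_cong[OF eq, of \<delta>] by (simp add: mult)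
  have "(\<delta> a * b - a * \<delta> b) * (q * q) = (\<delta> a * q) * (b * q) - (a * q) * (\<delta> b * q)"
    by (simp add: algebra_simps)
  also have "\<delta> a * q = \<delta> p * b + p * \<delta> b - a * \<delta> q"
    using d by simp
  also have "(\<delta> p * b + p * \<delta> b - a * \<delta> q) * (b * q) - (a * q) * (\<delta> b * q) =
      (\<delta> p * q) * (b * b) + (p * b) * (\<delta> b * q) - (a * q) * (\<delta> q * b) - (a * q) * (\<delta> b * q)"
    by (simp add: algebra_simps)
  also have "\<dots> = (\<delta> p * q - p * \<delta> q) * (b * b)"
    unfolding eq[symmetric] by (simp add: algebra_simps)
  finally have "Fract (\<delta> a * b - a * \<delta> b) (b * b) = Fract (\<delta> p * q - p * \<delta> q) (q * q)"
    using assms b by (simp add: eq_fract)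
  then show ?thesis
    by (simp add: fract_der_def Let_def s_def[symmetric] ab)
qed

lemma fract_der_to_fract: "fract_der \<delta> (to_fract p) = to_fract (\<delta> p)"
  by (simp add: to_fract_def fract_der_Fract)

lemma fract_der: "derivation (fract_der \<delta>)"
proof
  fix x y :: "'a fract"
  obtain p q where x: "x = Fract p q" "q \<noteq> 0" by (cases x)
  obtain p' q' where y: "y = Fract p' q'" "q' \<noteq> 0" by (cases y)
  show "fract_der \<delta> (x + y) = fract_der \<delta> x + fract_der \<delta> y"
    using x y by (simp add: fract_der_Fract eq_fract add mult) (simp add: algebra_simps)
  show "fract_der \<delta> (x * y) = fract_der \<delta> x * y + x * fract_der \<delta> y"
    using x y by (simp add: fract_der_Fract eq_fract add mult) (simp add: algebra_simps)
qed

end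

section \<open>Translation along a vector of rational functions\<close>

text \<open>This is p(x + t h) as a polynomial in t over K(x).\<close>

definition translate :: "(nat \<Rightarrow> 'a::field ratfun) \<Rightarrow> 'a mpoly \<Rightarrow> 'a ratfun poly" where
  "translate h p = (\<Sum>m\<in>Poly_Mapping.keys p. smult (to_fract (Const (Poly_Mapping.lookup p m)))
     (\<Prod>i\<in>Poly_Mapping.keys m. [:to_fract (Var i), h i:] ^ Poly_Mapping.lookup m i))"

lemma Const_0 [simp]: "Const 0 = 0" and Const_1 [simp]: "Const 1 = 1"
  by (simp_all add: Const_def)

lemma Const_add: "Const (a + b) = Const a + Const b"
  by (simp add: Const_def single_add)

lemma Const_mult: "Const (a * b) = Const a * Const b"
  by (simp add: Const_def mult_single)

lemma translate_add: "translate h (p + q) = translate h p + translate h q"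
proof -
  let ?K = "Poly_Mapping.keys p \<union> Poly_Mapping.keys q"
  have *: "translate h r = (\<Sum>m\<in>?K. smult (to_fract (Const (Poly_Mapping.lookup r m)))
     (\<Prod>i\<in>Poly_Mapping.keys m. [:to_fract (Var i), h i:] ^ Poly_Mapping.lookup m i))"
    if "Poly_Mapping.keys r \<subseteq> ?K" for r
    unfolding translate_def using that
    by (intro sum.mono_neutral_left) (auto simp: in_keys_iff)
  show ?thesis
    by (simp add: * Poly_Mapping.keys_add lookup_add Const_add smult_add_left sum.distrib)
qed

lemma translate_single: "translate h (Poly_Mapping.single m c) = smult (to_fract (Const c))
     (\<Prod>i\<in>Poly_Mapping.keys m. [:to_fract (Var i), h i:] ^ Poly_Mapping.lookup m i)"
  by (cases "c = 0") (simp_all add: translate_def)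

lemma prod_keys_add:
  fixes g :: "'b \<Rightarrow> 'c::comm_monoid_mult"
  shows "(\<Prod>i\<in>Poly_Mapping.keys (a + b). g i ^ Poly_Mapping.lookup (a + b) i) =
    (\<Prod>i\<in>Poly_Mapping.keys a. g i ^ Poly_Mapping.lookup a i) *
    (\<Prod>i\<in>Poly_Mapping.keys b. g i ^ Poly_Mapping.lookup b i)"
proof -
  let ?K = "Poly_Mapping.keys a \<union> Poly_Mapping.keys b"
  have *: "(\<Prod>i\<in>Poly_Mapping.keys m. g i ^ Poly_Mapping.lookup m i) =
      (\<Prod>i\<in>?K. g i ^ Poly_Mapping.lookup m i)"
    if "Poly_Mapping.keys m \<subseteq> ?K" for m
    using that by (intro prod.mono_neutral_left) (auto simp: in_keys_iff)
  show ?thesis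
    unfolding *[OF Poly_Mapping.keys_add] *[OF Un_upper1] *[OF Un_upper2]
    by (simp add: lookup_add power_add prod.distrib)
qed

lemma translate_mult: "translate h (p * q) = translate h p * translate h q"
proof (induction p rule: mpoly_additive_induct)
  case (single a c)
  show ?case
  proof (induction q rule: mpoly_additive_induct)
    case (single b d)
    show ?case
      by (simp add: mult_single translate_single prod_keys_add Const_mult mult.commute)
  qed (simp add: translate_add algebra_simps)
qed (simp add: translate_add algebra_simps)

lemma translate_Const [simp]: "translate h (Const c) = [:to_fract (Const c):]"
  by (simp add: Const_def translate_single)

lemma translate_Var [simp]: "translate h (Var i) = [:to_fract (Var i), h i:]"
  by (simp add: Var_def translate_single)

lemma mpoly_induct [case_names Const Var add mult]:
  fixes p :: "'a::comm_semiring_1 mpoly"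
  assumes const: "\<And>c. P (Const c)" and var: "\<And>i. P (Var i)"
    and add: "\<And>p q. P p \<Longrightarrow> P q \<Longrightarrow> P (p + q)"
    and mult: "\<And>p q. P p \<Longrightarrow> P q \<Longrightarrow> P (p * q)"
  shows "P p"
proof (induction p rule: mpoly_additive_induct)
  case (single m c)
  have pow: "P (Poly_Mapping.single (Poly_Mapping.single i k) 1)" for i k
  proof (induction k)
    case 0
    show ?case using const[of 1] by (simp add: Const_def)
  next
    case (Suc k)
    have "Poly_Mapping.single (Poly_Mapping.single i (Suc k)) (1::'a) =
        Var i * Poly_Mapping.single (Poly_Mapping.single i k) 1"
      by (simp add: Var_def mult_single flip: single_add)
    then show ?case by (simp add: mult var Suc)
  qed
  have "P (Poly_Mapping.single (\<Sum>i\<in>B. Poly_Mapping.single i (g i)) c)" if "finite B" for B g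
    using that
  proof (induction B rule: finite_induct)
    case empty
    show ?case using const[of c] by (simp add: Const_def)
  next
    case (insert i B)
    have "Poly_Mapping.single (\<Sum>i\<in>insert i B. Poly_Mapping.single i (g i)) c =
        Poly_Mapping.single (Poly_Mapping.single i (g i)) 1 *
        Poly_Mapping.single (\<Sum>i\<in>B. Poly_Mapping.single i (g i)) c"
      using insert by (simp add: mult_single)
    then show ?case using insert by (simp add: mult pow)
  qed
  from this[of "Poly_Mapping.keys m" "Poly_Mapping.lookup m"] show ?case
    by (simp add: poly_mapping_sum_monomials)
qed (rule add)

lemma coeff_translate_0: "coeff (translate h p) 0 = to_fract p"
  by (induction p rule: mpoly_induct) (simp_all add: translate_add translate_mult coeff_mult)

text \<open>
  If the coefficients of \<open>h\<close> are constants of the derivation \<open>\<Sum> h\<^sub>i \<partial>\<^sub>i\<close>, then translation along \<open>h\<close>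
  is the flow of this derivation.
\<close>

lemma pderiv_translate:
  fixes E :: "'a::field ratfun \<Rightarrow> 'a ratfun"
  assumes "derivation E"
    and const: "\<And>c. E (to_fract (Const c)) = 0"
    and var: "\<And>i. E (to_fract (Var i)) = h i"
    and flow: "\<And>i. E (h i) = 0"
  shows "pderiv (translate h p) = map_poly E (translate h p)"
proof -
  interpret derivation E by fact
  interpret P: derivation "map_poly E" by (rule map_poly)
  show ?thesis
    by (induction p rule: mpoly_induct)
      (simp_all add: translate_add translate_mult pderiv_add pderiv_mult P.add P.mult pderiv_pCons
        map_poly_pCons const var flow)
qed

text \<open>Both sides solve the differential equation dF/dt = E F with the same value at t = 0, and
  in characteristic zero this determines all coefficients recursively. The factor \<open>a\<close>
  plays the part of p/q, so fractions are handled although \<open>translate\<close> acts on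
  polynomials only.\<close>

lemma translate_eq_smult:
  fixes E :: "'a::field_char_0 ratfun \<Rightarrow> 'a ratfun"
  assumes E: "derivation E"
    and const: "\<And>c. E (to_fract (Const c)) = 0"
    and var: "\<And>i. E (to_fract (Var i)) = h i"
    and flow: "\<And>i. E (h i) = 0"
    and a: "E a = 0" "to_fract p = a * to_fract q"
  shows "translate h p = smult a (translate h q)"
proof (rule poly_eqI)
  interpret derivation E by fact
  have rec: "of_nat (Suc k) * coeff (translate h r) (Suc k) = E (coeff (translate h r) k)" for r k
    using arg_cong[OF pderiv_translate[OF E const var flow, of r], of "\<lambda>s. coeff s k"]
    by (simp add: coeff_pderiv coeff_map_poly)
  fix k
  show "coeff (translate h p) k = coeff (smult a (translate h q)) k"
  proof (induction k)
    case 0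
    show ?case by (simp add: coeff_translate_0 a)
  next
    case (Suc k)
    have "of_nat (Suc k) * coeff (translate h p) (Suc k) =
        of_nat (Suc k) * (a * coeff (translate h q) (Suc k))"
      using rec[of k p] rec[of k q] Suc by (simp add: mult a mult.left_commute del: of_nat_Suc)
    then show ?case by (simp del: of_nat_Suc)
  qed
qed

section \<open>Closure properties of adjoined fields\<close>

lemma adjoin_sum: "(\<And>i. i \<in> A \<Longrightarrow> g i \<in> adjoin S) \<Longrightarrow> (\<Sum>i\<in>A. g i) \<in> adjoin S"
proof (induction A rule: infinite_finite_induct)
  case (insert x F)
  then show ?case by (simp add: adjoin.add)
qed (use adjoin.const[of 0] in simp_all)

lemma adjoin_prod: "(\<And>i. i \<in> A \<Longrightarrow> g i \<in> adjoin S) \<Longrightarrow> (\<Prod>i\<in>A. g i) \<in> adjoin S"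
proof (induction A rule: infinite_finite_induct)
  case (insert x F)
  then show ?case by (simp add: adjoin.mult)
qed (use adjoin.const[of 1] in simp_all)

lemma adjoin_power: "a \<in> adjoin S \<Longrightarrow> a ^ k \<in> adjoin S"
  using adjoin_prod[of "{..<k}" "\<lambda>_. a" S] by simp

lemma adjoin_uminus: "a \<in> adjoin S \<Longrightarrow> - a \<in> adjoin S"
proof -
  assume "a \<in> adjoin S"
  then have "to_fract (Const (-1)) * a \<in> adjoin S"
    by (intro adjoin.mult adjoin.const)
  moreover have "Const (-1::'a) = -1"
    by (simp add: Const_def single_uminus)
  ultimately show ?thesis by simp
qed

lemma adjoin_diff: "a \<in> adjoin S \<Longrightarrow> b \<in> adjoin S \<Longrightarrow> a - b \<in> adjoin S"
  using adjoin.add[of a S "- b"] adjoin_uminus[of b S] by simp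

lemma adjoin_divide: "a \<in> adjoin S \<Longrightarrow> b \<in> adjoin S \<Longrightarrow> a / b \<in> adjoin S"
  unfolding divide_inverse by (intro adjoin.mult adjoin.inv)

lemma adjoin_subset: "S \<subseteq> adjoin T \<Longrightarrow> adjoin S \<subseteq> adjoin T"
proof
  fix a
  assume S: "S \<subseteq> adjoin T" and "a \<in> adjoin S"
  from this(2) show "a \<in> adjoin T"
    by induction (use S in \<open>auto intro: adjoin.intros\<close>)
qed

lemma poly_translate_in_adjoin:
  assumes "p \<in> polys n"
    and "\<And>i. i < n \<Longrightarrow> to_fract (Var i) + s * h i \<in> adjoin S"
  shows "poly (translate h p) s \<in> adjoin S"
  unfolding translate_def poly_sum poly_smult poly_prod poly_power
proof (intro adjoin_sum adjoin.mult adjoin.const adjoin_prod adjoin_power)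
  fix m i
  assume "m \<in> Poly_Mapping.keys p" "i \<in> Poly_Mapping.keys m"
  then have "i < n" using assms(1) by (auto simp: polys_def)
  then show "poly [:to_fract (Var i), h i:] s \<in> adjoin S" using assms(2) by simp
qed


section \<open>Polynomial vectors in the kernel of the Hessian\<close>

text \<open>
  Entries of a kernel vector may a priori involve variables beyond the first \<open>n\<close>. Differentiating by such
  a variable again gives a kernel vector, so among the vectors of minimal support one of minimal
  degree has entries in \<open>polys n\<close>.
\<close>

lemma minimal_kernel_vector:
  fixes A :: "nat \<Rightarrow> nat \<Rightarrow> 'a::field_char_0 mpoly" and n :: nat
  defines "ker \<equiv> \<lambda>G. \<forall>j<n. (\<Sum>i<n. G i * A i j) = 0"
  assumes A: "\<And>i j. A i j \<in> polys n"
    and det: "det (mat n n (\<lambda>(j, i). A i j)) = 0"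
  obtains H k where "k < n" "H k \<noteq> 0" "ker H" "\<forall>i<n. H i \<in> polys n"
    "\<forall>G. ker G \<longrightarrow> G k = 0 \<longrightarrow> (\<forall>i<n. H i = 0 \<longrightarrow> G i = 0) \<longrightarrow> (\<forall>i<n. G i = 0)"
proof -
  define supp where "supp G = {i. i < n \<and> G i \<noteq> 0}" for G :: "nat \<Rightarrow> 'a mpoly"
  define P where "P G \<longleftrightarrow> ker G \<and> supp G \<noteq> {}" for G
  have fin: "finite (supp G)" for G by (simp add: supp_def)
  let ?M = "mat n n (\<lambda>(j, i). A i j)"
  \<comment> \<open>The determinant criterion holds over integral domains, so \<open>v\<close> has
    polynomial entries.\<close>
  obtain v where v: "v \<in> carrier_vec n" "v \<noteq> 0\<^sub>v n" "?M *\<^sub>v v = 0\<^sub>v n"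
    using det det_0_iff_vec_prod_zero[of ?M n] by auto
  have "ker (\<lambda>i. v $ i)"
    unfolding ker_def
  proof (intro allI impI)
    fix j
    assume j: "j < n"
    have "(\<Sum>i<n. v $ i * A i j) = (?M *\<^sub>v v) $ j"
      using j v(1) by (simp add: scalar_prod_def atLeast0LessThan mult.commute)
    then show "(\<Sum>i<n. v $ i * A i j) = 0" using j v(3) by simp
  qed
  moreover have "supp (\<lambda>i. v $ i) \<noteq> {}"
    using v(1,2) by (auto simp: supp_def intro!: eq_vecI)
  ultimately have "P (\<lambda>i. v $ i)" by (simp add: P_def)
  then obtain H0 where H0: "P H0" "\<And>G. P G \<Longrightarrow> card (supp H0) \<le> card (supp G)"
    using ex_has_least_nat[of P _ "\<lambda>G. card (supp G)"] by blast
  \<comment> \<open>Second minimization: among the vectors of least support size, the degree bound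
    \<open>N\<close> is made least. The degree counts all variables, also those beyond the first
    \<open>n\<close>.\<close>
  define Q where "Q = (\<lambda>(G, N). P G \<and> card (supp G) = card (supp H0) \<and>
    (\<forall>i<n. \<forall>m\<in>Poly_Mapping.keys (G i). mdeg m \<le> N))"
  have "Q (H0, Max (\<Union>i<n. mdeg ` Poly_Mapping.keys (H0 i)))"
    unfolding Q_def by (auto intro!: H0(1) Max_ge)
  then obtain x where x: "Q x" "\<And>y. Q y \<Longrightarrow> snd x \<le> snd y"
    using ex_has_least_nat[of Q _ snd] by blast
  obtain H N where "x = (H, N)" by (cases x)
  with x have HN: "Q (H, N)" "\<And>G M. Q (G, M) \<Longrightarrow> N \<le> M"
    by fastforce+
  from HN(1) have H: "ker H" "supp H \<noteq> {}" "card (supp H) = card (supp H0)"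
    and bound: "\<And>i m. i < n \<Longrightarrow> m \<in> Poly_Mapping.keys (H i) \<Longrightarrow> mdeg m \<le> N"
    by (auto simp: Q_def P_def)
  from H(2) obtain k where k: "k < n" "H k \<noteq> 0" by (auto simp: supp_def)
  have minimal: "G i = 0"
    if G: "ker G" "G k = 0" "\<And>i. i < n \<Longrightarrow> H i = 0 \<Longrightarrow> G i = 0" and i: "i < n" for G i
  proof (rule ccontr)
    assume "G i \<noteq> 0"
    with G i have "P G" by (auto simp: P_def supp_def)
    moreover have "supp G \<subset> supp H"
      using G k by (auto simp: supp_def)
    then have "card (supp G) < card (supp H)"
      by (rule psubset_card_mono[OF fin])
    ultimately show False using H0(2)[of G] H(3) by simp
  qed
  have "H i \<in> polys n" if i: "i < n" for i
  proof (rule polys_if_pd_eq_0, rule ccontr)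
    fix j
    assume j: "n \<le> j" and nz: "pd j (H i) \<noteq> 0"
    define G where "G i = pd j (H i)" for i
    have "ker G"
      unfolding ker_def
    proof (intro allI impI)
      fix l
      assume "l < n"
      then have "pd j (\<Sum>i<n. H i * A i l) = 0"
        using H(1) by (simp add: ker_def)
      then show "(\<Sum>i<n. G i * A i l) = 0"
        using pd_eq_0[OF A j] by (simp add: pd_sum pd_mult G_def)
    qed
    moreover have "supp G \<noteq> {}" using i nz by (auto simp: supp_def G_def)
    ultimately have "P G" by (simp add: P_def)
    moreover have "card (supp G) \<le> card (supp H)"
      by (rule card_mono[OF fin]) (auto simp: supp_def G_def)
    ultimately have card: "card (supp G) = card (supp H0)"
      using H0(2)[of G] H(3) by simp
    have deg: "mdeg m < N" if "l < n" "m \<in> Poly_Mapping.keys (G l)" for l m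
      using bound[OF that(1) keys_pd[of m j "H l"]] that(2) by (simp add: G_def mdeg_add)
    then have "Q (G, N - 1)"
      using \<open>P G\<close> card by (force simp: Q_def)
    \<comment> \<open>Minimality gives \<open>N\<close> \<le> \<open>N - 1\<close>, which leaves
      only the truncated case \<open>N = 0\<close>; there the strict bound \<open>deg\<close>
      excludes the monomial found next.\<close>
    then have "N = 0" using HN(2) by fastforce
    moreover obtain m where "m \<in> Poly_Mapping.keys (G i)"
      using nz unfolding G_def by (metis all_not_in_conv keys_eq_empty)
    ultimately show False using deg[OF i] by simp
  qed
  then show thesis
    using minimal by (intro that[OF k H(1)]) blast+
qed

section \<open>Differentiation along a polynomial vector\<close>

definition dirder :: "nat \<Rightarrow> (nat \<Rightarrow> 'a mpoly) \<Rightarrow> 'a mpoly \<Rightarrow> 'a::comm_semiring_1 mpoly" where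
  "dirder n H p = (\<Sum>i<n. H i * pd i p)"

lemma derivation_dirder: "derivation (dirder n H)"
  by unfold_locales (simp_all add: dirder_def pd_add pd_mult sum.distrib sum_distrib_left
      sum_distrib_right algebra_simps)

lemma dirder_Const [simp]: "dirder n H (Const c) = 0"
  by (simp add: dirder_def)

lemma dirder_Var: "dirder n H (Var i) = (if i < n then H i else 0)"
  by (simp add: dirder_def pd_Var if_distrib[of "(*) _"] cong: if_cong)

text \<open>
  Since \<open>H\<close> annihilates the Hessian, differentiating this relation shows that the third-order
  form \<open>\<Sum> H\<^sub>i H\<^sub>m \<partial>\<^sub>i\<partial>\<^sub>m\<partial>\<^sub>j f\<close> vanishes.
\<close>

lemma dirder_kernel_vector:
  fixes f :: "'a::field mpoly"
  assumes ker: "\<And>j. (\<Sum>i<n. H i * pd i (pd j f)) = 0"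
  shows "(\<Sum>i<n. dirder n H (H i) * pd i (pd j f)) = 0"
proof -
  interpret derivation "dirder n H" by (rule derivation_dirder)
  have "0 = (\<Sum>i<n. H i * pd j (\<Sum>m<n. H m * pd m (pd i f)))"
    by (simp add: ker)
  also have "\<dots> = (\<Sum>i<n. \<Sum>m<n. H i * (pd j (H m) * pd m (pd i f))) +
      (\<Sum>i<n. \<Sum>m<n. H i * (H m * pd j (pd m (pd i f))))"
    by (simp add: pd_sum pd_mult sum_distrib_left sum.distrib distrib_left)
  also have "(\<Sum>i<n. \<Sum>m<n. H i * (pd j (H m) * pd m (pd i f))) =
      (\<Sum>m<n. pd j (H m) * (\<Sum>i<n. H i * pd i (pd m f)))"
    by (subst sum.swap) (simp add: sum_distrib_left mult.left_commute pd_commute)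
  also have "\<dots> = 0" by (simp add: ker)
  also have "(\<Sum>i<n. \<Sum>m<n. H i * (H m * pd j (pd m (pd i f)))) =
      (\<Sum>i<n. H i * dirder n H (pd i (pd j f)))"
    by (simp add: dirder_def sum_distrib_left pd_commute[of j])
  finally have third: "(\<Sum>i<n. H i * dirder n H (pd i (pd j f))) = 0" by simp
  \<comment> \<open>The product rule splits this into the desired sum and the third-order sum just
    shown to vanish.\<close>
  have "dirder n H (\<Sum>i<n. H i * pd i (pd j f)) = 0" by (simp add: ker)
  then show ?thesis by (simp add: sum mult sum.distrib third)
qed

text \<open>Euler's formula for the partial derivatives, of degree \<open>d - 1\<close>, turns
  \<open>d - 1\<close> times the derivative of \<open>f\<close> along \<open>H\<close> into a
  combination of kernel relations. As \<open>d\<close> is at least 2, this factor is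
  nonzero.\<close>

lemma dirder_eq_0:
  fixes f :: "'a::field_char_0 mpoly"
  assumes "f \<in> polys n" "homogeneous d f" "d \<ge> 2"
    and ker: "\<And>j. (\<Sum>i<n. H i * pd i (pd j f)) = 0"
  shows "dirder n H f = 0"
proof -
  obtain e where d: "d = Suc e" "e \<noteq> 0" using assms(3) by (cases d) auto
  have "of_nat e * dirder n H f = (\<Sum>j<n. H j * (of_nat e * pd j f))"
    by (simp add: dirder_def sum_distrib_left mult.left_commute)
  also have "\<dots> = (\<Sum>j<n. H j * (\<Sum>i<n. Var i * pd i (pd j f)))"
    using euler_homogeneous[OF polys_pd homogeneous_pd, of f n e] assms(1,2) d by simp
  also have "\<dots> = (\<Sum>i<n. Var i * (\<Sum>j<n. H j * pd j (pd i f)))"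
    unfolding sum_distrib_left
    by (subst sum.swap) (simp add: mult.left_commute pd_commute)
  also have "\<dots> = 0" by (simp add: ker)
  finally show ?thesis using d by simp
qed

section \<open>Construction of the birational change of variables\<close>

theorem theorem4p7:
  fixes f :: "'a::{alg_closed_field, field_char_0} mpoly"
    and n d :: nat
  assumes "f \<in> polys n"
    and "homogeneous d f"
    and "d \<ge> 2"
    and "zero_hessian n f"
  shows "\<exists>u :: nat \<Rightarrow> 'a ratfun.
           (\<forall>i<n. u i \<in> ratfuns n) \<and>
           adjoin (u ` {..<n}) = ratfuns n \<and>
           to_fract f \<in> adjoin (u ` {..<n - 1}) \<and>
           (\<forall>j<n. to_fract (pd j f) \<in> adjoin (u ` {..<n - 1}))"
proof -
  have "mat n n (\<lambda>(j, i). pd i (pd j f)) = hessian n f"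
    by (rule eq_matI) (simp_all add: hessian_def pd_commute)
  then have "det (mat n n (\<lambda>(j, i). pd i (pd j f))) = 0"
    using assms(4) by (simp add: zero_hessian_def)
  note kernel_vector =
    minimal_kernel_vector[of "\<lambda>i j. pd i (pd j f)", OF polys_pd[OF polys_pd[OF assms(1)]] this]
  obtain H k where k: "k < n" "H k \<noteq> 0"
    and ker': "\<forall>j<n. (\<Sum>i<n. H i * pd i (pd j f)) = 0"
    and H': "\<forall>i<n. H i \<in> polys n"
    and minimal: "\<forall>G. (\<forall>j<n. (\<Sum>i<n. G i * pd i (pd j f)) = 0) \<longrightarrow> G k = 0 \<longrightarrow>
      (\<forall>i<n. H i = 0 \<longrightarrow> G i = 0) \<longrightarrow> (\<forall>i<n. G i = 0)"
    by (rule kernel_vector, rule that)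
  from H' have H: "H i \<in> polys n" if "i < n" for i using that by blast
  have ker: "(\<Sum>i<n. H i * pd i (pd j f)) = 0" for j
    using ker' pd_eq_0[OF assms(1), of j] by (cases "j < n") simp_all
  let ?D = "dirder n H"
  interpret D: derivation ?D by (rule derivation_dirder)
  \<comment> \<open>These are the numerators of the derivatives of \<open>H i / H k\<close> under
    the quotient rule.\<close>
  let ?G = "\<lambda>i. ?D (H i) * H k - H i * ?D (H k)"
  have "\<forall>j<n. (\<Sum>i<n. ?G i * pd i (pd j f)) = 0"
  proof (intro allI impI)
    fix j
    have "(\<Sum>i<n. ?G i * pd i (pd j f)) =
        H k * (\<Sum>i<n. ?D (H i) * pd i (pd j f)) - ?D (H k) * (\<Sum>i<n. H i * pd i (pd j f))"
      by (simp add: sum_distrib_left sum_subtractf algebra_simps)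
    then show "(\<Sum>i<n. ?G i * pd i (pd j f)) = 0"
      by (simp add: ker dirder_kernel_vector)
  qed
  moreover have "?G k = 0" "\<forall>i<n. H i = 0 \<longrightarrow> ?G i = 0" by simp_all
  ultimately have proportional: "?G i = 0" if "i < n" for i
    using minimal[rule_format, of ?G] that by blast

  \<comment> \<open>The value 0 beyond \<open>n\<close> makes \<open>var\<close> and
    \<open>flow\<close> below hold for every index. Dividing \<open>?D\<close> by \<open>H k\<close>
    normalizes \<open>E\<close> so that x_k has derivative 1.\<close>
  define h where "h i = (if i < n then Fract (H i) (H k) else 0)" for i
  define E where "E x = inverse (to_fract (H k)) * fract_der ?D x" for x
  have h_mult: "to_fract (H i) = h i * to_fract (H k)" if "i < n" for i
    using that k by (simp add: h_def Fract_conv_to_fract)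
  have E: "derivation E"
    unfolding E_def by (intro derivation.scale D.fract_der)
  have E_to_fract: "E (to_fract p) = inverse (to_fract (H k)) * to_fract (?D p)" for p
    by (simp add: E_def D.fract_der_to_fract)
  have const: "E (to_fract (Const c)) = 0" for c
    by (simp add: E_to_fract)
  have var: "E (to_fract (Var i)) = h i" for i
    by (simp add: E_to_fract dirder_Var h_def Fract_conv_to_fract field_simps)
  have flow: "E (h i) = 0" for i
    using proportional[of i] k derivation.zero[OF E]
    by (simp add: E_def h_def D.fract_der_Fract fract_collapse)
  note smult = translate_eq_smult[OF E const var flow]
  \<comment> \<open>The case \<open>q = 1\<close> and \<open>a = to_fract p\<close> of
    \<open>translate_eq_smult\<close>.\<close>
  have invariant: "translate h p = [:to_fract p:]" if "?D p = 0" for p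
    using smult[of "to_fract p" p 1] that translate_Const[of h 1] by (simp add: E_to_fract one_pCons)
  have invariant_f: "translate h f = [:to_fract f:]"
    by (rule invariant, rule dirder_eq_0[OF assms(1-3) ker])
  have invariant_pd: "translate h (pd j f) = [:to_fract (pd j f):]" for j
    by (rule invariant) (simp add: dirder_def ker)
  have translate_H: "translate h (H i) = smult (h i) (translate h (H k))" if "i < n" for i
    using smult[OF flow h_mult[OF that]] .

  \<comment> \<open>Since \<open>h k = 1\<close>, translating by \<open>s c\<close> sends x_k to the
    scalar \<open>c\<close>.\<close>
  define s where "s c = to_fract (Const c) - to_fract (Var k)" for c :: 'a
  have "translate h (H k) \<noteq> 0"
    using k coeff_translate_0[of h "H k"] by auto
  then have "finite {x. poly (translate h (H k)) x = 0}"
    by (rule poly_roots_finite)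
  moreover have "inj s"
  proof (rule injI)
    fix a b
    assume "s a = s b"
    then have "Const a = Const b" by (simp add: s_def)
    then show "a = b" unfolding Const_def by (metis lookup_single_eq)
  qed
  then have "infinite (range s)"
    by (simp add: finite_image_iff infinite_UNIV_char_0)
  ultimately obtain c where c: "poly (translate h (H k)) (s c) \<noteq> 0"
    by (metis (mono_tags, lifting) finite_subset image_subsetI mem_Collect_eq)

  \<comment> \<open>The k-th translated coordinate would be the constant \<open>c\<close>, so x_k
    itself takes its place; the transposition then moves it to the last position.\<close>
  define w where "w i = (if i = k then to_fract (Var k) else to_fract (Var i) + s c * h i)" for i
  define u where "u = w \<circ> transpose k (n - 1)"
  let ?W = "w ` ({..<n} - {k})"
  have "transpose k (n - 1) ` {..<n} = {..<n}"
    using k(1) by (intro transpose_image_eq) auto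
  then have img: "u ` {..<n} = w ` {..<n}"
    unfolding u_def image_comp[symmetric] by simp
  have "{..<n - 1} = {..<n} - {n - 1}" using k(1) by auto
  also have "transpose k (n - 1) ` ({..<n} - {n - 1}) = {..<n} - {k}"
    using \<open>transpose k (n - 1) ` {..<n} = {..<n}\<close> by (simp add: image_set_diff)
  finally have img': "u ` {..<n - 1} = ?W"
    unfolding u_def image_comp[symmetric] by simp

  have h_k: "h k = 1" using k by (simp add: h_def One_fract_def eq_fract)
  have coord: "to_fract (Var i) + s c * h i \<in> adjoin ?W" if "i < n" for i
  proof (cases "i = k")
    case True
    then show ?thesis by (simp add: h_k s_def adjoin.const)
  next
    case False
    then have "w i \<in> ?W" using that by blast
    then have "w i \<in> adjoin ?W" by (rule adjoin.incl)
    then show ?thesis using False by (simp add: w_def)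
  qed
  have value_in: "poly (translate h p) (s c) \<in> adjoin ?W" if "p \<in> polys n" for p
    using that coord by (rule poly_translate_in_adjoin)
  have f_in: "to_fract f \<in> adjoin ?W"
    using value_in[OF assms(1)] by (simp add: invariant_f)
  have pd_in: "to_fract (pd j f) \<in> adjoin ?W" for j
    using value_in[OF polys_pd[OF assms(1)], of j] by (simp add: invariant_pd)
  have h_in: "h i \<in> adjoin ?W" if "i < n" for i
  proof -
    \<comment> \<open>As \<open>h i\<close> is invariant, translating numerator and denominator does
      not change their quotient; the choice of \<open>c\<close> keeps the denominator
      nonzero.\<close>
    have "h i = poly (translate h (H i)) (s c) / poly (translate h (H k)) (s c)"
      using c by (simp add: translate_H[OF that])
    then show ?thesis
      using value_in[OF H[OF that]] value_in[OF H[OF k(1)]] by (simp add: adjoin_divide)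
  qed

  have var_in: "to_fract (Var i) \<in> ratfuns n" if "i < n" for i
    by (rule to_fract_in_ratfuns[OF polys_Var[OF that]])
  have w_in: "w i \<in> ratfuns n" if "i < n" for i
  proof -
    have "h i \<in> ratfuns n"
      using that k H[OF that] H[OF k(1)] by (auto simp: h_def ratfuns_def)
    then show ?thesis
      using var_in[OF that] var_in[OF k(1)] unfolding w_def s_def ratfuns_eq_adjoin
      by (auto intro: adjoin.intros adjoin_diff)
  qed
  have sub: "adjoin ?W \<subseteq> adjoin (w ` {..<n})"
    by (intro adjoin_subset) (auto intro: adjoin.incl)
  have k_in: "to_fract (Var k) \<in> adjoin (w ` {..<n})"
    using k(1) adjoin.incl[of "w k" "w ` {..<n}"] by (simp add: w_def)
  have "to_fract (Var i) \<in> adjoin (w ` {..<n})" if "i < n" for i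
  proof -
    \<comment> \<open>With x_k adjoined, \<open>s c\<close> is available, so the translation can be
      undone.\<close>
    have "to_fract (Var i) = (to_fract (Var i) + s c * h i) - s c * h i" by simp
    moreover have "to_fract (Var i) + s c * h i \<in> adjoin (w ` {..<n})" "h i \<in> adjoin (w ` {..<n})"
      using coord[OF that] h_in[OF that] sub by blast+
    moreover have "s c \<in> adjoin (w ` {..<n})"
      unfolding s_def by (intro adjoin_diff adjoin.const k_in)
    ultimately show ?thesis by (metis adjoin_diff adjoin.mult)
  qed
  then have "ratfuns n \<subseteq> adjoin (w ` {..<n})"
    unfolding ratfuns_eq_adjoin by (intro adjoin_subset) auto
  moreover have "adjoin (w ` {..<n}) \<subseteq> ratfuns n"
    unfolding ratfuns_eq_adjoin[of n]
    by (intro adjoin_subset) (auto simp: w_in simp flip: ratfuns_eq_adjoin)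
  moreover have "\<forall>i<n. u i \<in> ratfuns n"
    using w_in img by (metis imageE imageI lessThan_iff)
  ultimately show ?thesis
    using f_in pd_in by (intro exI[of _ u]) (simp only: img img', blast)
qed

end
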